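(* Let $(R,+,\cdot)$ be a hyperring and put $\alpha_{\cup}=\alpha_{\times}\cup\alpha_{+}$. Then $\alpha^{*}=\alpha_{\cup}^{*}=(\alpha_{\times}\cup\alpha_{+})^{*}$.
   Context: A hyperoperation on a non-empty set $H$ is a map $\circ$ from $H\times H$ to the non-empty subsets of $H$; for non-empty $A,B\subseteq H$, $A\circ B=\bigcup_{a\in A,b\in B}a\circ b$, and elements are identified with singletons. $(H,\circ)$ is a semi-hypergroup if $x\circ(y\circ z)=(x\circ y)\circ z$ for all $x,y,z$, and a hypergroup if moreover $x\circ H=H\circ x=H$ for all $x\in H$. A hyperring $(R,+,\cdot)$ consists of a hypergroup $(R,+)$ (not assumed commutative) and a semi-hypergroup $(R,\cdot)$ (no unit assumed, not assumed commutative) such that $x\cdot(y+z)=x\cdot y+x\cdot z$ and $(x+y)\cdot z=x\cdot z+y\cdot z$ for all $x,y,z\in R$. For $n\in\mathbb{N}=\{1,2,\dots\}$, $k_i\in\mathbb{N}$ and $x_{ij}\in R$, $\sum_{i=1}^{n}\prod_{j=1}^{k_i}x_{ij}$ denotes the subset of $R$ obtained by the iterated hyperoperations, in the indicated order (a product with one factor $x$ is $\{x\}$). $S_n$ is the symmetric group on $\{1,\dots,n\}$. Relations on $R$: - $\alpha_0=\{(x,x)\mid x\in R\}$; for $n\ge 1$, $x\,\alpha_n\,y$ iff there exist $(k_1,\dots,k_n)\in\mathbb{N}^n$, $\sigma\in S_n$, and for each $i$ elements $x_{i1},\dots,x_{ik_i}\in R$ and $\sigma_i\in S_{k_i}$ such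 that $x\in\sum_{i=1}^n\prod_{j=1}^{k_i}x_{ij}$ and $y\in\sum_{i=1}^n A_{\sigma(i)}$, where $A_i=\prod_{j=1}^{k_i}x_{i\,\sigma_i(j)}$; and $\alpha=\bigcup_{n\ge0}\alpha_n$. - $x\,\alpha_{+}\,y$ iff there exist $n\in\mathbb{N}$, $(k_1,\dots,k_n)\in\mathbb{N}^n$, $\sigma\in S_n$ and elements $x_{ij}\in R$ ($1\le i\le n$, $1\le j\le k_i$) such that $x\in\sum_{i=1}^n\prod_{j=1}^{k_i}x_{ij}$ and $y\in\sum_{i=1}^n A_{\sigma(i)}$, where $A_i=\prod_{j=1}^{k_i}x_{ij}$. - $x\,\alpha_{\times}\,y$ iff there exist $n\in\mathbb{N}$, $(k_1,\dots,k_n)\in\mathbb{N}^n$ and, for each $i$, elements $x_{i1},\dots,x_{ik_i}\in R$ and $\sigma_i\in S_{k_i}$ such that $x\in\sum_{i=1}^n\prod_{j=1}^{k_i}x_{ij}$ and $y\in\sum_{i=1}^n\prod_{j=1}^{k_i}x_{i\,\sigma_i(j)}$. For a relation $\rho$, $\rho^{*}$ denotes its transitive closure. *)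

theory Defs
  imports "HOL-Combinatorics.Permutations"
begin

type_synonym 'a hyperop = "'a \<Rightarrow> 'a \<Rightarrow> 'a set"

definition set_hop :: "'a hyperop \<Rightarrow> 'a set \<Rightarrow> 'a set \<Rightarrow> 'a set" where
  "set_hop f A B = (\<Union>a\<in>A. \<Union>b\<in>B. f a b)"

locale semihypergroup =
  fixes H :: "'a set" and f :: "'a hyperop"
  assumes carrier_nonempty: "H \<noteq> {}"
    and hop_closed: "\<lbrakk>x \<in> H; y \<in> H\<rbrakk> \<Longrightarrow> f x y \<subseteq> H"
    and hop_nonempty: "\<lbrakk>x \<in> H; y \<in> H\<rbrakk> \<Longrightarrow> f x y \<noteq> {}"
    and hop_assoc: "\<lbrakk>x \<in> H; y \<in> H; z \<in> H\<rbrakk> \<Longrightarrow>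
      set_hop f {x} (f y z) = set_hop f (f x y) {z}"

locale hypergroup = semihypergroup +
  assumes reproduction_left: "x \<in> H \<Longrightarrow> set_hop f {x} H = H"
    and reproduction_right: "x \<in> H \<Longrightarrow> set_hop f H {x} = H"

locale hyperring =
  add: hypergroup R add + mul: semihypergroup R mul
  for R :: "'a set" and add :: "'a hyperop" and mul :: "'a hyperop" +
  assumes distrib_left: "\<lbrakk>x \<in> R; y \<in> R; z \<in> R\<rbrakk> \<Longrightarrow>
      set_hop mul {x} (add y z) = set_hop add (mul x y) (mul x z)"
    and distrib_right: "\<lbrakk>x \<in> R; y \<in> R; z \<in> R\<rbrakk> \<Longrightarrow>
      set_hop mul (add x y) {z} = set_hop add (mul x z) (mul y z)"

text \<open>The set \<open>A 1 \<circ> \<dots> \<circ> A n\<close>, bracketed to the left; by associativity the bracketing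
  is immaterial.  It is only meaningful for \<open>n \<ge> 1\<close>; the value at \<open>0\<close> is a dummy.\<close>

primrec hop_iter :: "'a hyperop \<Rightarrow> (nat \<Rightarrow> 'a set) \<Rightarrow> nat \<Rightarrow> 'a set" where
  "hop_iter f A 0 = {}"
| "hop_iter f A (Suc n) = (if n = 0 then A 1 else set_hop f (hop_iter f A n) (A (Suc n)))"

definition hsum :: "'a hyperop \<Rightarrow> nat \<Rightarrow> (nat \<Rightarrow> 'a set) \<Rightarrow> 'a set" where
  "hsum add n A = hop_iter add A n"

definition hprod :: "'a hyperop \<Rightarrow> nat \<Rightarrow> (nat \<Rightarrow> 'a) \<Rightarrow> 'a set" where
  "hprod mul k x = hop_iter mul (\<lambda>j. {x j}) k"

text \<open>A family \<open>(x\<^sub>i\<^sub>j)\<close> with \<open>1 \<le> i \<le> n\<close> and \<open>1 \<le> j \<le> k\<^sub>i\<close> is encoded by total functions \<open>k\<close>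
  and \<open>x\<close>, of which only the values in this index range matter.\<close>

definition family_in :: "'a set \<Rightarrow> nat \<Rightarrow> (nat \<Rightarrow> nat) \<Rightarrow> (nat \<Rightarrow> nat \<Rightarrow> 'a) \<Rightarrow> bool" where
  "family_in R n k x \<longleftrightarrow> (\<forall>i\<in>{1..n}. 1 \<le> k i \<and> (\<forall>j\<in>{1..k i}. x i j \<in> R))"

definition alpha_n :: "'a set \<Rightarrow> 'a hyperop \<Rightarrow> 'a hyperop \<Rightarrow> nat \<Rightarrow> 'a rel" where
  "alpha_n R add mul n =
    (if n = 0 then Id_on R
     else {(u, v). \<exists>k \<sigma> x \<tau>.
        family_in R n k x \<and> \<sigma> permutes {1..n} \<and> (\<forall>i\<in>{1..n}. \<tau> i permutes {1..k i}) \<and>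
        u \<in> hsum add n (\<lambda>i. hprod mul (k i) (x i)) \<and>
        (let A = (\<lambda>i. hprod mul (k i) (\<lambda>j. x i (\<tau> i j)))
         in v \<in> hsum add n (\<lambda>i. A (\<sigma> i)))})"

definition alpha :: "'a set \<Rightarrow> 'a hyperop \<Rightarrow> 'a hyperop \<Rightarrow> 'a rel" where
  "alpha R add mul = (\<Union>n. alpha_n R add mul n)"

definition alpha_plus :: "'a set \<Rightarrow> 'a hyperop \<Rightarrow> 'a hyperop \<Rightarrow> 'a rel" where
  "alpha_plus R add mul =
    {(u, v). \<exists>n k \<sigma> x.
        1 \<le> n \<and> family_in R n k x \<and> \<sigma> permutes {1..n} \<and>
        u \<in> hsum add n (\<lambda>i. hprod mul (k i) (x i)) \<and>
        (let A = (\<lambda>i. hprod mul (k i) (x i))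
         in v \<in> hsum add n (\<lambda>i. A (\<sigma> i)))}"

definition alpha_times :: "'a set \<Rightarrow> 'a hyperop \<Rightarrow> 'a hyperop \<Rightarrow> 'a rel" where
  "alpha_times R add mul =
    {(u, v). \<exists>n k x \<tau>.
        1 \<le> n \<and> family_in R n k x \<and> (\<forall>i\<in>{1..n}. \<tau> i permutes {1..k i}) \<and>
        u \<in> hsum add n (\<lambda>i. hprod mul (k i) (x i)) \<and>
        v \<in> hsum add n (\<lambda>i. hprod mul (k i) (\<lambda>j. x i (\<tau> i j)))}"

definition alpha_cup :: "'a set \<Rightarrow> 'a hyperop \<Rightarrow> 'a hyperop \<Rightarrow> 'a rel" where
  "alpha_cup R add mul = alpha_times R add mul \<union> alpha_plus R add mul"

end

theory Submission
  imports Defs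
begin

text \<open>
  The relation \<open>\<alpha>\<close> permutes the factors inside the summands and the summands themselves in one
  step, whereas \<open>\<alpha>\<^sub>\<times>\<close> does only the former and \<open>\<alpha>\<^sub>+\<close> only the latter.  Taking
  one of the two kinds of permutation to be the identity gives \<open>\<alpha>\<^sub>\<times> \<union> \<alpha>\<^sub>+ \<subseteq> \<alpha>\<close>.
  Conversely an \<open>\<alpha>\<close>-step from \<open>u\<close> to \<open>v\<close> factors through any element \<open>w\<close> of the sum in which the
  factors, but not yet the summands, have been permuted: \<open>u\<close> is \<open>\<alpha>\<^sub>\<times>\<close>-related to \<open>w\<close>, and
  \<open>w\<close> is \<open>\<alpha>\<^sub>+\<close>-related to \<open>v\<close>.  Such a \<open>w\<close> exists because sums of products are
  non-empty (\<open>sum_of_products_nonempty\<close>).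
  Hence (\<open>alpha_n_subset_times_plus\<close>) \<open>\<alpha> \<subseteq> \<alpha>\<^sub>\<times> O \<alpha>\<^sub>+\<close>, up to the diagonal \<open>\<alpha>\<^sub>0\<close>, which already
  lies in \<open>\<alpha>\<^sub>+\<close>, and the transitive closures agree.
\<close>

lemma set_hop_nonempty:
  assumes "semihypergroup H f" "A \<subseteq> H" "A \<noteq> {}" "B \<subseteq> H" "B \<noteq> {}"
  shows "set_hop f A B \<noteq> {}"
proof -
  obtain a b where "a \<in> A" "b \<in> B"
    using assms(3,5) by blast
  moreover have "f a b \<noteq> {}"
    using semihypergroup.hop_nonempty[OF assms(1)] calculation assms(2,4) by blast
  ultimately show ?thesis
    by (auto simp: set_hop_def)
qed

lemma set_hop_closed:
  assumes "semihypergroup H f" "A \<subseteq> H" "B \<subseteq> H"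
  shows "set_hop f A B \<subseteq> H"
  using semihypergroup.hop_closed[OF assms(1)] assms(2,3) unfolding set_hop_def by blast

lemma hop_iter_closed_nonempty:
  assumes "semihypergroup H f" "1 \<le> n" "\<And>i. i \<in> {1..n} \<Longrightarrow> A i \<subseteq> H \<and> A i \<noteq> {}"
  shows "hop_iter f A n \<subseteq> H \<and> hop_iter f A n \<noteq> {}"
  using assms(2,3)
proof (induction n rule: nat_induct_at_least)
  case base
  then show ?case by simp
next
  case (Suc n)
  have "hop_iter f A n \<subseteq> H \<and> hop_iter f A n \<noteq> {}"
    using Suc by simp
  moreover have "A (Suc n) \<subseteq> H \<and> A (Suc n) \<noteq> {}"
    using Suc.prems[of "Suc n"] by simp
  ultimately show ?case
    using Suc.hyps set_hop_closed[OF assms(1)] set_hop_nonempty[OF assms(1)] by simp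
qed

lemma sum_of_products_nonempty:
  assumes "hyperring R add mul" "family_in R n k x" "1 \<le> n"
  shows "hsum add n (\<lambda>i. hprod mul (k i) (x i)) \<noteq> {}"
proof -
  interpret hyperring R add mul by fact
  have "hprod mul (k i) (x i) \<subseteq> R \<and> hprod mul (k i) (x i) \<noteq> {}" if "i \<in> {1..n}" for i
    unfolding hprod_def
    using assms(2) that
    by (intro hop_iter_closed_nonempty[OF mul.semihypergroup_axioms])
       (auto simp: family_in_def)
  then show ?thesis
    unfolding hsum_def
    by (rule conjunct2[OF hop_iter_closed_nonempty[OF add.semihypergroup_axioms assms(3)]])
qed

lemma family_in_permute_factors:
  assumes "family_in R n k x" "\<forall>i\<in>{1..n}. \<tau> i permutes {1..k i}"
  shows "family_in R n k (\<lambda>i j. x i (\<tau> i j))"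
proof -
  have "\<tau> i j \<in> {1..k i}" if "i \<in> {1..n}" "j \<in> {1..k i}" for i j
    using permutes_in_image[OF bspec[OF assms(2) that(1)]] that(2) by blast
  then show ?thesis
    using assms(1) unfolding family_in_def by blast
qed

text \<open>Each element of \<open>R\<close> is a sum with one summand, which is a product with one factor.\<close>

lemma Id_on_subset_alpha_plus: "Id_on R \<subseteq> alpha_plus R add mul"
proof
  fix p assume "p \<in> Id_on R"
  then obtain u where u: "u \<in> R" "p = (u, u)" by auto
  then have "family_in R 1 (\<lambda>_. 1) (\<lambda>_ _. u)" "u \<in> hsum add 1 (\<lambda>i. hprod mul 1 (\<lambda>_. u))"
    by (auto simp: family_in_def hsum_def hprod_def)
  then show "p \<in> alpha_plus R add mul"
    unfolding alpha_plus_def u(2) Let_def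
    by (intro CollectI case_prodI)
       (rule exI[of _ 1], rule exI[of _ "\<lambda>_. 1"], rule exI[of _ id],
        rule exI[of _ "\<lambda>_ _. u"], simp)
qed

text \<open>
  The intermediate element comes from the sum with permuted factors and unpermuted summands.
  The second step is then the summand permutation applied to the family \<open>x\<^sub>i\<^sub>j\<close> reindexed by
  \<open>\<tau>\<^sub>i\<close>, which has the same lengths \<open>k\<^sub>i\<close>.
\<close>

lemma alpha_n_subset_times_plus:
  assumes "hyperring R add mul" "1 \<le> n"
  shows "alpha_n R add mul n \<subseteq> alpha_times R add mul O alpha_plus R add mul"
proof clarify
  fix u v assume "(u, v) \<in> alpha_n R add mul n"
  then obtain k \<sigma> x \<tau> where
    x: "family_in R n k x" and \<sigma>: "\<sigma> permutes {1..n}"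
    and \<tau>: "\<forall>i\<in>{1..n}. \<tau> i permutes {1..k i}"
    and u: "u \<in> hsum add n (\<lambda>i. hprod mul (k i) (x i))"
    and v: "v \<in> hsum add n (\<lambda>i. hprod mul (k (\<sigma> i)) (\<lambda>j. x (\<sigma> i) (\<tau> (\<sigma> i) j)))"
    using assms(2) unfolding alpha_n_def Let_def by (auto split: if_splits)
  define y where "y = (\<lambda>i j. x i (\<tau> i j))"
  have y: "family_in R n k y"
    unfolding y_def using family_in_permute_factors[OF x \<tau>] .
  obtain w where w: "w \<in> hsum add n (\<lambda>i. hprod mul (k i) (y i))"
    using sum_of_products_nonempty[OF assms(1) y assms(2)] by blast
  have "(u, w) \<in> alpha_times R add mul"
    unfolding alpha_times_def
    by (intro CollectI case_prodI)
       (rule exI[of _ n], rule exI[of _ k], rule exI[of _ x], rule exI[of _ \<tau>],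
        use assms(2) x \<tau> u w in \<open>simp add: y_def\<close>)
  moreover have "v \<in> hsum add n (\<lambda>i. hprod mul (k (\<sigma> i)) (y (\<sigma> i)))"
    using v unfolding y_def .
  then have "(w, v) \<in> alpha_plus R add mul"
    unfolding alpha_plus_def Let_def
    by (intro CollectI case_prodI)
       (rule exI[of _ n], rule exI[of _ k], rule exI[of _ \<sigma>], rule exI[of _ y],
        use assms(2) y \<sigma> w in simp)
  ultimately show "(u, v) \<in> alpha_times R add mul O alpha_plus R add mul"
    by blast
qed

lemma alpha_subset_trancl_alpha_cup:
  assumes "hyperring R add mul"
  shows "alpha R add mul \<subseteq> (alpha_cup R add mul)\<^sup>+"
proof -
  have "alpha_n R add mul n \<subseteq> (alpha_cup R add mul)\<^sup>+" for n
  proof (cases "n = 0")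
    case True
    then show ?thesis
      using Id_on_subset_alpha_plus[of R add mul] by (auto simp: alpha_n_def alpha_cup_def)
  next
    case False
    then have "alpha_n R add mul n \<subseteq> alpha_times R add mul O alpha_plus R add mul"
      by (intro alpha_n_subset_times_plus[OF assms]) simp
    also have "\<dots> \<subseteq> (alpha_cup R add mul)\<^sup>+"
      unfolding alpha_cup_def by (auto intro: trancl_into_trancl2)
    finally show ?thesis .
  qed
  then show ?thesis
    unfolding alpha_def by blast
qed

lemma alpha_plus_subset_alpha: "alpha_plus R add mul \<subseteq> alpha R add mul"
proof clarify
  fix u v assume "(u, v) \<in> alpha_plus R add mul"
  then obtain n k \<sigma> x where *: "1 \<le> n" "family_in R n k x" "\<sigma> permutes {1..n}"
    "u \<in> hsum add n (\<lambda>i. hprod mul (k i) (x i))"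
    "v \<in> hsum add n (\<lambda>i. hprod mul (k (\<sigma> i)) (x (\<sigma> i)))"
    unfolding alpha_plus_def Let_def by blast
  have "(u, v) \<in> alpha_n R add mul n"
    using *
    by (simp add: alpha_n_def Let_def)
       (rule exI[of _ k], rule exI[of _ \<sigma>], rule exI[of _ x], rule conjI,
        assumption, rule conjI, assumption, rule exI[of _ "\<lambda>_. id"], simp)
  then show "(u, v) \<in> alpha R add mul"
    unfolding alpha_def by blast
qed

lemma alpha_times_subset_alpha: "alpha_times R add mul \<subseteq> alpha R add mul"
proof clarify
  fix u v assume "(u, v) \<in> alpha_times R add mul"
  then obtain n k x \<tau> where *: "1 \<le> n" "family_in R n k x"
    "\<forall>i\<in>{1..n}. \<tau> i permutes {1..k i}"
    "u \<in> hsum add n (\<lambda>i. hprod mul (k i) (x i))"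
    "v \<in> hsum add n (\<lambda>i. hprod mul (k i) (\<lambda>j. x i (\<tau> i j)))"
    unfolding alpha_times_def by blast
  have "(u, v) \<in> alpha_n R add mul n"
    using *
    by (simp add: alpha_n_def Let_def)
       (rule exI[of _ k], rule exI[of _ id], rule exI[of _ x], rule conjI,
        assumption, rule conjI, rule permutes_id, rule exI[of _ \<tau>], simp)
  then show "(u, v) \<in> alpha R add mul"
    unfolding alpha_def by blast
qed

theorem corollary1p7:
  fixes R :: "'a set" and add mul :: "'a \<Rightarrow> 'a \<Rightarrow> 'a set"
  assumes "hyperring R add mul"
  shows "(alpha R add mul)\<^sup>+ = (alpha_cup R add mul)\<^sup>+ \<and>
         (alpha_cup R add mul)\<^sup>+ = (alpha_times R add mul \<union> alpha_plus R add mul)\<^sup>+"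
proof
  have "alpha_cup R add mul \<subseteq> alpha R add mul"
    unfolding alpha_cup_def
    by (intro Un_least alpha_times_subset_alpha alpha_plus_subset_alpha)
  then have "(alpha_cup R add mul)\<^sup>+ \<subseteq> (alpha R add mul)\<^sup>+"
    by (rule trancl_mono_subset)
  moreover have "(alpha R add mul)\<^sup>+ \<subseteq> ((alpha_cup R add mul)\<^sup>+)\<^sup>+"
    using alpha_subset_trancl_alpha_cup[OF assms] by (rule trancl_mono_subset)
  then have "(alpha R add mul)\<^sup>+ \<subseteq> (alpha_cup R add mul)\<^sup>+"
    by simp
  ultimately show "(alpha R add mul)\<^sup>+ = (alpha_cup R add mul)\<^sup>+"
    by blast
qed (simp add: alpha_cup_def)

end
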